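(* Suppose that $f, F$ are analytic functions in the unit disc $\mathbb D$ and that $F$ is bound preserving. Then, for every $p$ with $1\le p\le\infty$, $$M_p(r, f\star F)\,\le\, M_p(r, f),\qquad 0<r<1.$$
   Context: $\mathbb D=\{z\in\mathbb C:|z|<1\}$. For analytic $f$ in $\mathbb D$ and $0\le r<1$, $M_p(r,f)=\left(\int_{-\pi}^{\pi}|f(re^{it})|^p\,\frac{dt}{2\pi}\right)^{1/p}$ if $0<p<\infty$, and $M_\infty(r,f)=\sup_{|z|=r}|f(z)|$. $H^\infty$ is the space of bounded analytic functions in $\mathbb D$ with $\|f\|_{H^\infty}=\sup_{z\in\mathbb D}|f(z)|$. For $f(z)=\sum_{n\ge0}a_nz^n$ and $g(z)=\sum_{n\ge0}b_nz^n$ analytic in $\mathbb D$, the (Hadamard) convolution is $(f\star g)(z)=\sum_{n\ge0}a_nb_nz^n$, $z\in\mathbb D$. An analytic function $F$ in $\mathbb D$ is called bound preserving if for every $f\in H^\infty$ we have $f\star F\in H^\infty$ and $\|f\star F\|_{H^\infty}\le\|f\|_{H^\infty}$. *)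

theory Defs
  imports "HOL-Complex_Analysis.Complex_Analysis"
begin

abbreviation unit_disc :: "complex set" where
  "unit_disc \<equiv> ball 0 1"

text \<open>
  Functions on the unit disc are total functions on the complex plane; all notions below only
  depend on their values in the disc.
\<close>

text \<open>
  The exponent ranges over \<open>(0, \<infinity>]\<close>. For \<open>f\<close> analytic in the disc and \<open>0 \<le> r < 1\<close>, the integrand
  is continuous and the set of values on the circle is bounded, so the real-valued integral and
  supremum are the usual ones.
\<close>

definition integral_mean :: "ereal \<Rightarrow> real \<Rightarrow> (complex \<Rightarrow> complex) \<Rightarrow> real" where
  "integral_mean p r f =
     (if p = \<infinity> then (SUP z\<in>sphere 0 r. norm (f z))
      else (LBINT t:{-pi..pi}. norm (f (of_real r * cis t)) powr real_of_ereal p / (2 * pi))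
             powr (1 / real_of_ereal p))"

definition Hinf :: "(complex \<Rightarrow> complex) set" where
  "Hinf = {f. f analytic_on unit_disc \<and> bounded (f ` unit_disc)}"

definition Hinf_norm :: "(complex \<Rightarrow> complex) \<Rightarrow> real" where
  "Hinf_norm f = (SUP z\<in>unit_disc. norm (f z))"

definition hadamard_conv ::
    "(complex \<Rightarrow> complex) \<Rightarrow> (complex \<Rightarrow> complex) \<Rightarrow> complex \<Rightarrow> complex"  (infixl \<open>\<star>\<close> 70) where
  "(f \<star> g) z = (\<Sum>n. fps_nth (fps_expansion f 0) n * fps_nth (fps_expansion g 0) n * z ^ n)"

definition bound_preserving :: "(complex \<Rightarrow> complex) \<Rightarrow> bool" where
  "bound_preserving F \<longleftrightarrow>
     F analytic_on unit_disc \<and>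
     (\<forall>f\<in>Hinf. f \<star> F \<in> Hinf \<and> Hinf_norm (f \<star> F) \<le> Hinf_norm f)"

end

theory Submission
  imports Defs
begin

text \<open>
  Testing \<open>F\<close> on polynomials shows that its Taylor coefficients define a functional of norm at most
  one for the supremum norm on the unit circle. Instead of representing it by a complex measure, a
  finite-dimensional separation argument approximates any initial segment of the coefficients by a
  convex combination of sequences \<open>k \<mapsto> c * \<zeta> ^ k\<close> with \<open>\<bar>c\<bar> = \<bar>\<zeta>\<bar> = 1\<close>. Hence, on the circle of
  radius \<open>r\<close>, \<open>f \<star> F\<close> is a uniform limit of convex combinations of the functions
  \<open>z \<mapsto> c * f (\<zeta> * z)\<close>, which have the same integral means as \<open>f\<close>; convexity of \<open>x powr p\<close> and
  dominated convergence conclude.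
\<close>

section \<open>Bound preserving functions as functionals on polynomials\<close>

lemma fps_nth_expansion_polynomial:
  fixes \<alpha> :: "nat \<Rightarrow> complex"
  shows "fps_nth (fps_expansion (\<lambda>z. \<Sum>k\<le>n. \<alpha> k * z ^ k) 0) k = (if k \<le> n then \<alpha> k else 0)"
proof -
  have "(\<lambda>z. \<Sum>k\<le>n. \<alpha> k * z ^ k) has_fps_expansion Abs_fps (\<lambda>k. if k \<le> n then \<alpha> k else 0)"
  proof (intro has_fps_expansionI always_eventually allI)
    fix u :: complex
    have "(\<lambda>k. fps_nth (Abs_fps (\<lambda>k. if k \<le> n then \<alpha> k else 0)) k * u ^ k) sums
            (\<Sum>k\<le>n. fps_nth (Abs_fps (\<lambda>k. if k \<le> n then \<alpha> k else 0)) k * u ^ k)"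
      by (rule sums_finite) auto
    then show "(\<lambda>k. fps_nth (Abs_fps (\<lambda>k. if k \<le> n then \<alpha> k else 0)) k * u ^ k) sums
            (\<Sum>k\<le>n. \<alpha> k * u ^ k)"
      by simp
  qed
  from fps_expansion_eqI[OF this] show ?thesis
    by simp
qed

lemma hadamard_conv_polynomial:
  "((\<lambda>z. \<Sum>k\<le>n. \<alpha> k * z ^ k) \<star> F) z =
     (\<Sum>k\<le>n. \<alpha> k * fps_nth (fps_expansion F 0) k * z ^ k)"
  unfolding hadamard_conv_def fps_nth_expansion_polynomial
  by (subst suminf_finite[of "{..n}"]) auto

text \<open>The maximum principle carries the bound \<open>M\<close> from the circle to the
  polynomial on the whole disc. Bound preservation passes it on to the convolution with
  \<open>F\<close>, whose value at 1 is the sum in question.\<close>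

lemma bound_preserving_functional:
  fixes \<alpha> :: "nat \<Rightarrow> complex"
  assumes F: "bound_preserving F"
    and M: "\<And>\<zeta>. norm \<zeta> = 1 \<Longrightarrow> norm (\<Sum>k\<le>n. \<alpha> k * \<zeta> ^ k) \<le> M"
  shows "norm (\<Sum>k\<le>n. \<alpha> k * fps_nth (fps_expansion F 0) k) \<le> M"
proof -
  define P where "P = (\<lambda>z. \<Sum>k\<le>n. \<alpha> k * z ^ k)"
  define Q where "Q = (\<lambda>z. \<Sum>k\<le>n. \<alpha> k * fps_nth (fps_expansion F 0) k * z ^ k)"
  have PM: "norm (P z) \<le> M" if "z \<in> unit_disc" for z
  proof (rule maximum_modulus_frontier[of P unit_disc])
    show "P holomorphic_on interior unit_disc" "continuous_on (closure unit_disc) P"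
      unfolding P_def by (intro holomorphic_intros continuous_intros)+
  qed (use that M in \<open>auto simp: P_def\<close>)
  have "P \<in> Hinf"
  proof -
    have "P analytic_on unit_disc"
      unfolding P_def by (intro analytic_intros)
    moreover have "bounded (P ` unit_disc)"
      using PM unfolding bounded_iff by blast
    ultimately show ?thesis
      by (simp add: Hinf_def)
  qed
  moreover have "P \<star> F = Q"
    by (rule ext) (simp add: P_def Q_def hadamard_conv_polynomial)
  ultimately have Q: "Q \<in> Hinf" "Hinf_norm Q \<le> Hinf_norm P"
    using F by (auto simp: bound_preserving_def)
  have "Hinf_norm P \<le> M"
    unfolding Hinf_norm_def by (rule cSUP_least) (use PM in auto)
  have QM: "norm (Q z) \<le> M" if "z \<in> unit_disc" for z
  proof -
    have "bdd_above ((\<lambda>z. norm (Q z)) ` unit_disc)"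
      using Q(1) by (auto simp: Hinf_def bounded_iff bdd_above_def)
    then have "norm (Q z) \<le> Hinf_norm Q"
      unfolding Hinf_norm_def using that by (rule cSUP_upper2) auto
    then show ?thesis
      using Q(2) \<open>Hinf_norm P \<le> M\<close> by linarith
  qed
  \<comment> \<open>\<open>Hinf_norm\<close> controls \<open>Q\<close> only inside the open disc, so
    the boundary point 1 is reached as a radial limit.\<close>
  have "continuous (at_left 1) (\<lambda>s::real. norm (Q (of_real s)))"
    unfolding Q_def by (intro continuous_intros)
  then have lim: "((\<lambda>s::real. norm (Q (of_real s))) \<longlongrightarrow> norm (Q 1)) (at_left 1)"
    by (simp add: continuous_within)
  have "\<forall>\<^sub>F s in at_left 1. norm (Q (of_real s)) \<le> M"
    using eventually_at_left_real[of 0 "1::real"]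
    by (auto elim!: eventually_mono intro!: QM)
  then have "norm (Q 1) \<le> M"
    by (intro tendsto_upperbound[OF lim]) auto
  then show ?thesis
    by (simp add: Q_def)
qed

section \<open>The convex hull of the circle characters\<close>

text \<open>These are the moment sequences of finitely supported complex measures on the unit circle
  with total variation at most one. The inductive form lets every estimate be checked on characters
  and carried through binary convex combinations.\<close>

inductive_set circle_hull :: "(nat \<Rightarrow> complex) set" where
  character: "norm c = 1 \<Longrightarrow> norm \<zeta> = 1 \<Longrightarrow> (\<lambda>k. c * \<zeta> ^ k) \<in> circle_hull"
| convex: "x \<in> circle_hull \<Longrightarrow> y \<in> circle_hull \<Longrightarrow> 0 \<le> t \<Longrightarrow> t \<le> 1 \<Longrightarrow>
    (\<lambda>k. of_real (1 - t) * x k + of_real t * y k) \<in> circle_hull"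

lemma norm_convex_combination_le:
  fixes u v :: complex
  assumes "0 \<le> t" "t \<le> 1"
  shows "norm (of_real (1 - t) * u + of_real t * v) \<le> (1 - t) * norm u + t * norm v"
proof -
  have "norm (of_real (1 - t) * u + of_real t * v) \<le>
      norm (of_real (1 - t) * u) + norm (of_real t * v)"
    by (rule norm_triangle_ineq)
  also have "\<dots> = (1 - t) * norm u + t * norm v"
    using assms by (simp only: norm_mult norm_of_real abs_of_nonneg diff_ge_0_iff_ge)
  finally show ?thesis .
qed

lemma circle_hull_norm_le:
  assumes "x \<in> circle_hull"
  shows "norm (x k) \<le> 1"
  using assms
proof induction
  case (character c \<zeta>)
  then show ?case
    by (simp add: norm_mult norm_power)
next
  case (convex x y t)
  have "(1 - t) * norm (x k) + t * norm (y k) \<le> 1"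
    by (rule convex_bound_le) (use convex in auto)
  then show ?case
    using norm_convex_combination_le[OF convex(3,4)] order_trans by blast
qed

text \<open>
  If \<open>x\<close> nearly minimises the distance from \<open>b\<close> to the hull, then the functional represented by
  \<open>b - x\<close> nearly separates \<open>b\<close> from the hull, and testing it on the characters bounds that distance.
\<close>

lemma bound_preserving_coeffs_approx:
  assumes F: "bound_preserving F" and "0 < e"
  shows "\<exists>x\<in>circle_hull. (\<Sum>k\<le>n. (norm (fps_nth (fps_expansion F 0) k - x k))\<^sup>2) \<le> e"
proof -
  define b where "b = fps_nth (fps_expansion F 0)"
  define D where "D = (\<lambda>x. \<Sum>k\<le>n. (norm (b k - x k))\<^sup>2)"
  \<comment> \<open>\<open>C\<close> bounds the squared distance between two hull elements on the
    indices up to \<open>n\<close>: there are \<open>n + 1\<close> coordinates, each differing by at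
    most 2. The number \<open>t\<close> is the length of a step from \<open>x\<close> towards
    another hull point; the cap 1 keeps that step inside the hull.\<close>
  define C where "C = 4 * (real n + 1)"
  define t where "t = min 1 (2 * e / (C + 1))"
  define S where "S = (INF x\<in>circle_hull. D x)"
  have C: "C > 0"
    by (simp add: C_def)
  then have t: "0 < t" "t \<le> 1" and "t \<le> 2 * e / (C + 1)"
    using \<open>0 < e\<close> by (auto simp: t_def)
  then have te: "(C + 1) * t / 2 \<le> e"
    using C by (simp add: field_simps)
  have ne: "circle_hull \<noteq> {}"
    using circle_hull.character[of 1 1] by auto
  have "bdd_below (D ` circle_hull)"
    by (rule bdd_belowI2[of _ 0]) (simp add: D_def sum_nonneg)
  then have S: "S \<le> D x" if "x \<in> circle_hull" for x
    unfolding S_def using that by (rule cINF_lower)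
  \<comment> \<open>A minimiser might not exist, so slack \<open>t\<^sup>2\<close> is allowed. It
    has the order of the quadratic term of the step, so dividing by \<open>2 * t\<close> below
    leaves an error of only \<open>(C + 1) * t / 2\<close>.\<close>
  obtain x where x: "x \<in> circle_hull" "D x < S + t\<^sup>2"
    using cINF_less_iff[OF ne \<open>bdd_below (D ` circle_hull)\<close>, of "S + t\<^sup>2"] t
    by (auto simp: S_def)
  \<comment> \<open>Conjugation makes the real part of the pairing with \<alpha> the real inner
    product with \<open>b - x\<close>.\<close>
  define \<alpha> where "\<alpha> = (\<lambda>k. cnj (b k - x k))"
  define M where "M = Re (\<Sum>k\<le>n. \<alpha> k * x k) + (C + 1) * t / 2"
  have *: "Re (\<Sum>k\<le>n. \<alpha> k * y k) \<le> M" if y: "y \<in> circle_hull" for y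
  proof -
    \<comment> \<open>First variation: moving from \<open>x\<close> a fraction \<open>t\<close>
      towards \<open>y\<close> cannot lower \<open>D\<close> by more than \<open>t\<^sup>2\<close>,
      which bounds the linear term of the expansion of \<open>D w\<close>.\<close>
    define w where "w = (\<lambda>k. of_real (1 - t) * x k + of_real t * y k)"
    have "w \<in> circle_hull"
      unfolding w_def using x(1) y t by (intro circle_hull.convex) auto
    have sq: "(norm (b k - w k))\<^sup>2 = (norm (b k - x k))\<^sup>2 - 2 * t * Re (\<alpha> k * (y k - x k))
        + t\<^sup>2 * (norm (y k - x k))\<^sup>2" for k
      unfolding w_def \<alpha>_def cmod_power2
      by (simp add: algebra_simps power2_eq_square)
    have "D w = D x - 2 * t * Re (\<Sum>k\<le>n. \<alpha> k * (y k - x k)) + t\<^sup>2 * (\<Sum>k\<le>n. (norm (y k - x k))\<^sup>2)"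
      unfolding D_def sq by (simp add: sum.distrib sum_subtractf sum_distrib_left del: times_complex.sel)
    moreover have "(\<Sum>k\<le>n. (norm (y k - x k))\<^sup>2) \<le> C"
    proof -
      have "(norm (y k - x k))\<^sup>2 \<le> 2\<^sup>2" for k
        using norm_triangle_ineq4[of "y k" "x k"] circle_hull_norm_le[OF x(1), of k]
          circle_hull_norm_le[OF y, of k] by (intro power_mono) auto
      then have "(\<Sum>k\<le>n. (norm (y k - x k))\<^sup>2) \<le> (\<Sum>k\<le>n. 2\<^sup>2)"
        by (intro sum_mono)
      then show ?thesis
        by (simp add: C_def)
    qed
    then have "t\<^sup>2 * (\<Sum>k\<le>n. (norm (y k - x k))\<^sup>2) \<le> t\<^sup>2 * C"
      by (intro mult_left_mono) auto
    ultimately have "2 * t * Re (\<Sum>k\<le>n. \<alpha> k * (y k - x k)) \<le> t\<^sup>2 + t\<^sup>2 * C"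
      using S[OF \<open>w \<in> circle_hull\<close>] x(2) by linarith
    then have "t * (2 * Re (\<Sum>k\<le>n. \<alpha> k * (y k - x k))) \<le> t * ((C + 1) * t)"
      by (simp add: power2_eq_square algebra_simps)
    then have "2 * Re (\<Sum>k\<le>n. \<alpha> k * (y k - x k)) \<le> (C + 1) * t"
      using t by (rule_tac mult_left_le_imp_le) auto
    then show ?thesis
      by (simp add: M_def right_diff_distrib sum_subtractf)
  qed
  have M: "norm (\<Sum>k\<le>n. \<alpha> k * \<zeta> ^ k) \<le> M" if "norm \<zeta> = 1" for \<zeta>
  proof -
    define u where "u = (\<Sum>k\<le>n. \<alpha> k * \<zeta> ^ k)"
    \<comment> \<open>The factor \<open>c\<close> turns \<open>u\<close> onto the nonnegative real
      axis, so the bound on real parts over the hull becomes a bound on the modulus. The value 1 at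
      \<open>u = 0\<close> keeps \<open>c\<close> unimodular.\<close>
    define c where "c = (if u = 0 then 1 else cnj (sgn u))"
    have "norm c = 1"
      by (simp add: c_def norm_sgn)
    have "c * u = of_real (norm u)"
      by (cases "u = 0") (auto simp: c_def sgn_eq complex_norm_square[symmetric] power2_eq_square
          mult.commute[of "cnj u"])
    moreover have "(\<Sum>k\<le>n. \<alpha> k * (c * \<zeta> ^ k)) = c * u"
      by (simp add: u_def sum_distrib_left mult.left_commute)
    ultimately have "norm u = Re (\<Sum>k\<le>n. \<alpha> k * (c * \<zeta> ^ k))"
      by simp
    also have "\<dots> \<le> M"
      using *[OF circle_hull.character[OF \<open>norm c = 1\<close> that]] .
    finally show ?thesis
      by (simp add: u_def)
  qed
  \<comment> \<open>The bound on the circle now transfers to the coefficients of \<open>F\<close>.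
    Pairing \<alpha> with \<open>b - x\<close> gives exactly \<open>D x\<close>, so the separation
    error bounds the distance itself.\<close>
  have "Re (\<Sum>k\<le>n. \<alpha> k * b k) \<le> M"
    using bound_preserving_functional[OF F M] complex_Re_le_cmod order_trans
    unfolding b_def by blast
  moreover have "D x = Re (\<Sum>k\<le>n. \<alpha> k * b k) - Re (\<Sum>k\<le>n. \<alpha> k * x k)"
    unfolding D_def \<alpha>_def cmod_power2
    by (simp add: sum_subtractf[symmetric] power2_eq_square algebra_simps)
  ultimately have "D x \<le> e"
    using te by (simp add: M_def)
  then show ?thesis
    using x(1) unfolding D_def b_def by blast
qed

section \<open>Multiplying Taylor coefficients by a sequence\<close>

text \<open>A bare sequence as second factor puts hull elements and the Taylor coefficients of
  \<open>F\<close> on the same footing.\<close>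

definition multiplier :: "(complex \<Rightarrow> complex) \<Rightarrow> (nat \<Rightarrow> complex) \<Rightarrow> complex \<Rightarrow> complex" where
  "multiplier f x z = (\<Sum>n. fps_nth (fps_expansion f 0) n * x n * z ^ n)"

lemma hadamard_conv_eq_multiplier:
  "f \<star> F = multiplier f (fps_nth (fps_expansion F 0))"
  by (rule ext) (simp add: hadamard_conv_def multiplier_def)

text \<open>Test the functional on the monomial of degree \<open>k\<close>, which is unimodular on
  the circle.\<close>

lemma bound_preserving_coeff_norm_le:
  assumes "bound_preserving F"
  shows "norm (fps_nth (fps_expansion F 0) k) \<le> 1"
proof -
  have "norm (\<Sum>j\<le>k. (if j = k then 1 else 0) * fps_nth (fps_expansion F 0) j) \<le> 1"
    by (rule bound_preserving_functional[OF assms]) (simp add: if_distribR if_distrib[of "\<lambda>u. u * _"] norm_power cong: if_cong)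
  then show ?thesis
    by (simp add: if_distrib[of "\<lambda>u. u * _"] cong: if_cong)
qed

context
  fixes f :: "complex \<Rightarrow> complex" and r :: real
  assumes f: "f analytic_on unit_disc" and r: "0 < r" "r < 1"
begin

lemma taylor_sums:
  assumes "norm z < 1"
  shows "(\<lambda>n. fps_nth (fps_expansion f 0) n * z ^ n) sums f z"
  using holomorphic_power_series[of f 0 1 z] f assms
  by (simp add: fps_expansion_def analytic_imp_holomorphic)

lemma taylor_abs_summable: "summable (\<lambda>n. norm (fps_nth (fps_expansion f 0) n) * r ^ n)"
proof -
  have "f holomorphic_on eball 0 1"
    using f by (simp add: one_ereal_def analytic_imp_holomorphic)
  then have "fps_conv_radius (fps_expansion f 0) \<ge> 1"
    by (rule conv_radius_fps_expansion)
  then have "ereal (norm (of_real r :: complex)) < conv_radius (fps_nth (fps_expansion f 0))"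
    using r by (auto simp: fps_conv_radius_def one_ereal_def intro: less_le_trans[of _ "ereal 1"])
  from abs_summable_in_conv_radius[OF this] show ?thesis
    using r by (simp add: norm_mult norm_power)
qed

text \<open>A majorant independent of both \<open>x\<close> and the point of the circle; it yields
  summability, a uniform bound and continuity for all these multipliers.\<close>

lemma multiplier_term_norm_le:
  assumes "\<And>n. norm (x n) \<le> 1" "norm z = r"
  shows "norm (fps_nth (fps_expansion f 0) n * x n * z ^ n)
      \<le> norm (fps_nth (fps_expansion f 0) n) * r ^ n"
proof -
  have "norm (x n) * (norm (fps_nth (fps_expansion f 0) n) * r ^ n)
      \<le> 1 * (norm (fps_nth (fps_expansion f 0) n) * r ^ n)"
    using assms r by (intro mult_right_mono) auto
  then show ?thesis
    using assms by (simp add: norm_mult norm_power mult_ac)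
qed

lemma multiplier_summable:
  assumes "\<And>n. norm (x n) \<le> 1" "norm z = r"
  shows "summable (\<lambda>n. fps_nth (fps_expansion f 0) n * x n * z ^ n)"
  by (rule summable_comparison_test'[OF taylor_abs_summable])
    (use multiplier_term_norm_le[of x z] assms in auto)

lemma multiplier_norm_le:
  assumes "\<And>n. norm (x n) \<le> 1" "norm z = r"
  shows "norm (multiplier f x z) \<le> (\<Sum>n. norm (fps_nth (fps_expansion f 0) n) * r ^ n)"
  unfolding multiplier_def
  by (rule norm_suminf_le[OF multiplier_term_norm_le[of x z] taylor_abs_summable]) (use assms in auto)

lemma continuous_on_multiplier:
  assumes "\<And>n. norm (x n) \<le> 1"
  shows "continuous_on (sphere 0 r) (multiplier f x)"
proof (rule uniform_limit_theorem)
  show "uniform_limit (sphere 0 r)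
      (\<lambda>m z. \<Sum>n<m. fps_nth (fps_expansion f 0) n * x n * z ^ n) (multiplier f x) sequentially"
    unfolding multiplier_def
    by (rule Weierstrass_m_test[OF _ taylor_abs_summable])
      (use multiplier_term_norm_le[of x] assms in auto)
  show "\<forall>\<^sub>F m in sequentially. continuous_on (sphere 0 r)
      (\<lambda>z. \<Sum>n<m. fps_nth (fps_expansion f 0) n * x n * z ^ n)"
    by (intro always_eventually allI continuous_intros)
qed auto

text \<open>The powers of \<zeta> merge with those of \<open>z\<close>, so a character acts as a
  rotation of the argument.\<close>

lemma multiplier_character:
  assumes "norm \<zeta> = 1" "norm z = r"
  shows "multiplier f (\<lambda>k. c * \<zeta> ^ k) z = c * f (\<zeta> * z)"
proof -
  have "(\<lambda>n. fps_nth (fps_expansion f 0) n * (\<zeta> * z) ^ n) sums f (\<zeta> * z)"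
    by (rule taylor_sums) (use assms r in \<open>simp add: norm_mult\<close>)
  from sums_mult[OF this, of c]
  have "(\<lambda>n. fps_nth (fps_expansion f 0) n * (c * \<zeta> ^ n) * z ^ n) sums (c * f (\<zeta> * z))"
    by (simp add: power_mult_distrib mult_ac)
  then show ?thesis
    by (simp add: multiplier_def sums_iff)
qed

lemma multiplier_linear_combination:
  assumes "\<And>n. norm (x n) \<le> 1" "\<And>n. norm (y n) \<le> 1" "norm z = r"
  shows "multiplier f (\<lambda>k. s * x k + t * y k) z = s * multiplier f x z + t * multiplier f y z"
proof -
  have "(\<lambda>n. s * (fps_nth (fps_expansion f 0) n * x n * z ^ n)
        + t * (fps_nth (fps_expansion f 0) n * y n * z ^ n))
      sums (s * multiplier f x z + t * multiplier f y z)"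
    unfolding multiplier_def
    using multiplier_summable assms by (intro sums_add sums_mult summable_sums) auto
  then show ?thesis
    by (simp add: multiplier_def sums_iff algebra_simps)
qed

text \<open>Only finitely many coefficients need to be close: beyond them, the coefficients of
  \<open>x\<close> and \<open>F\<close> differ by at most 2 and the Taylor series of
  \<open>f\<close> has a small absolute tail.\<close>

lemma hadamard_conv_approx:
  assumes F: "bound_preserving F" and "0 < e"
  shows "\<exists>x\<in>circle_hull. \<forall>z\<in>sphere 0 r. norm (multiplier f x z - (f \<star> F) z) \<le> e"
proof -
  define A where "A = (\<lambda>n. norm (fps_nth (fps_expansion f 0) n) * r ^ n)"
  define b where "b = fps_nth (fps_expansion F 0)"
  have A: "summable A" "\<And>n. A n \<ge> 0"
    using taylor_abs_summable r by (auto simp: A_def)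
  have "suminf A \<ge> 0"
    using A by (rule suminf_nonneg)
  obtain N where N: "\<And>m. m \<ge> N \<Longrightarrow> norm (\<Sum>i. A (i + m)) < e / 4"
    using suminf_exist_split[OF _ A(1), of "e / 4"] \<open>0 < e\<close> by auto
  \<comment> \<open>Half of \<open>e\<close> is reserved for the head and half for the tail, whose
    bound \<open>e / 4\<close> gets doubled. The added 1 avoids division by zero when
    \<open>suminf A\<close> vanishes.\<close>
  define d where "d = e / (2 * (suminf A + 1))"
  have "d > 0" and dA: "d * suminf A \<le> e / 2"
    using \<open>suminf A \<ge> 0\<close> \<open>0 < e\<close> by (auto simp: d_def field_simps)
  obtain x where x: "x \<in> circle_hull" "(\<Sum>k\<le>N. (norm (b k - x k))\<^sup>2) \<le> d\<^sup>2"
    using bound_preserving_coeffs_approx[OF F, of "d\<^sup>2" N] \<open>d > 0\<close> by (auto simp: b_def)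
  have x1: "norm (x k) \<le> 1" and b1: "norm (b k) \<le> 1" for k
    using circle_hull_norm_le[OF x(1)] bound_preserving_coeff_norm_le[OF F] by (auto simp: b_def)
  have near: "norm (x k - b k) \<le> d" if "k \<le> N" for k
  proof -
    have "(norm (b k - x k))\<^sup>2 \<le> (\<Sum>k\<le>N. (norm (b k - x k))\<^sup>2)"
      using that by (intro member_le_sum) auto
    with x(2) have "(norm (b k - x k))\<^sup>2 \<le> d\<^sup>2"
      by linarith
    then have "norm (b k - x k) \<le> d"
      by (rule power2_le_imp_le) (use \<open>d > 0\<close> in simp)
    then show ?thesis
      by (simp add: norm_minus_commute)
  qed
  have far: "norm (x k - b k) \<le> 2" for k
    using norm_triangle_ineq4[of "x k" "b k"] x1[of k] b1[of k] by linarith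
  \<comment> \<open>The head error is charged to every index, so that its sum is simply
    \<open>d * suminf A\<close>.\<close>
  define B where "B = (\<lambda>n. d * A n + (if n < N then 0 else 2 * A n))"
  have tail: "(\<lambda>n. if n < N then 0 else 2 * A n) sums (2 * (\<Sum>i. A (i + N)))"
  proof -
    have "(\<lambda>i. 2 * A (i + N)) sums (2 * (\<Sum>i. A (i + N)))"
      using A(1) by (intro sums_mult summable_sums) (simp add: summable_iff_shift)
    then show ?thesis
      by (subst sums_zero_iff_shift[of N, symmetric]) auto
  qed
  have B: "B sums (d * suminf A + 2 * (\<Sum>i. A (i + N)))"
    unfolding B_def using A(1) tail by (intro sums_add sums_mult summable_sums)
  have "norm (multiplier f x z - (f \<star> F) z) \<le> e" if z: "z \<in> sphere 0 r" for z
  proof -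
    have "norm z = r"
      using z by simp
    then have diff: "(\<lambda>n. fps_nth (fps_expansion f 0) n * x n * z ^ n
          - fps_nth (fps_expansion f 0) n * b n * z ^ n) sums (multiplier f x z - (f \<star> F) z)"
      unfolding hadamard_conv_eq_multiplier b_def[symmetric] multiplier_def
      using multiplier_summable x1 b1 by (intro sums_diff summable_sums) auto
    have "norm (fps_nth (fps_expansion f 0) n * x n * z ^ n
          - fps_nth (fps_expansion f 0) n * b n * z ^ n) \<le> B n" for n
    proof -
      have "norm (fps_nth (fps_expansion f 0) n * x n * z ^ n
          - fps_nth (fps_expansion f 0) n * b n * z ^ n)
          = norm (fps_nth (fps_expansion f 0) n * z ^ n * (x n - b n))"
        by (simp add: algebra_simps)
      also have "\<dots> = A n * norm (x n - b n)"
        using \<open>norm z = r\<close> by (simp add: A_def norm_mult norm_power)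
      also have "\<dots> \<le> A n * (if n < N then d else 2)"
        using near[of n] far[of n] A(2) by (intro mult_left_mono) auto
      also have "\<dots> \<le> B n"
        using A(2)[of n] \<open>d > 0\<close> by (auto simp: B_def)
      finally show ?thesis .
    qed
    from norm_suminf_le[OF this sums_summable[OF B]]
    have "norm (multiplier f x z - (f \<star> F) z) \<le> suminf B"
      by (simp only: sums_unique[OF diff, symmetric])
    also have "\<dots> = d * suminf A + 2 * (\<Sum>i. A (i + N))"
      using B by (simp add: sums_iff)
    also have "\<dots> \<le> e"
      using dA N[of N] by auto
    finally show ?thesis .
  qed
  then show ?thesis
    using x(1) by blast
qed

section \<open>Integral means of multipliers\<close>

lemma continuous_on_sphere: "continuous_on (sphere 0 r) f"
proof -
  have "continuous_on unit_disc f"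
    by (rule holomorphic_on_imp_continuous_on[OF analytic_imp_holomorphic[OF f]])
  then show ?thesis
    by (rule continuous_on_subset) (use r in auto)
qed

end

text \<open>Shifting the window drops the piece over \<open>{a..a + s}\<close> and adds the one over
  \<open>{b..b + s}\<close>; periodicity makes their integrals equal.\<close>

lemma integral_periodic_shift:
  fixes h :: "real \<Rightarrow> real"
  assumes h: "continuous_on UNIV h" and per: "\<And>x. h (x + (b - a)) = h x" and "a \<le> b" "0 \<le> s"
  shows "integral {a..b} (\<lambda>t. h (t + s)) = integral {a..b} h"
proof -
  have int: "h integrable_on {u..v}" for u v
    by (rule integrable_continuous_real[OF continuous_on_subset[OF h]]) auto
  have shift: "integral {u..v} (\<lambda>t. h (t + c)) = integral {u + c..v + c} h" for u v c
    using integral_shift[of u c v h] continuous_on_subset[OF h] by (simp add: o_def)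
  have "integral {a..a + s} h = integral {b..b + s} h"
    using shift[of a "a + s" "b - a"] per by (simp add: add_ac)
  moreover have "integral {a..a + s} h + integral {a + s..b + s} h = integral {a..b + s} h"
    and "integral {a..b} h + integral {b..b + s} h = integral {a..b + s} h"
    by (rule Henstock_Kurzweil_Integration.integral_combine; use assms int in auto)+
  ultimately show ?thesis
    by (simp add: shift)
qed

lemma continuous_on_circle_mean_integrand:
  assumes "continuous_on (sphere 0 r) u" "0 < r" "0 < q"
  shows "continuous_on S (\<lambda>t. norm (u (of_real r * cis t)) powr q / (2 * pi))"
proof -
  have "continuous_on S (\<lambda>t. u (of_real r * cis t))"
    using assms by (intro continuous_on_compose2[OF assms(1)] continuous_intros)
      (auto simp: norm_mult)
  then show ?thesis
    using assms by (intro continuous_on_divide continuous_on_powr' continuous_on_norm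
        continuous_on_const) auto
qed

lemma circle_mean_rotate:
  assumes u: "continuous_on (sphere 0 r) u" and "0 < r" "0 < q" "norm \<zeta> = 1"
  shows "(LBINT t:{-pi..pi}. norm (u (\<zeta> * (of_real r * cis t))) powr q / (2 * pi)) =
    (LBINT t:{-pi..pi}. norm (u (of_real r * cis t)) powr q / (2 * pi))"
proof -
  define h where "h = (\<lambda>t. norm (u (of_real r * cis t)) powr q / (2 * pi))"
  \<comment> \<open>The choice of argument in \<open>Arg2pi\<close> makes the shift nonnegative, as
    the periodic shift requires.\<close>
  define s where "s = Arg2pi \<zeta>"
  have "s \<ge> 0"
    by (simp add: s_def Arg2pi_ge_0)
  have \<zeta>: "\<zeta> = cis s"
    using \<open>norm \<zeta> = 1\<close> by (simp add: s_def cis_conv_exp complex_norm_eq_1_exp)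
  have h: "continuous_on S h" for S
    unfolding h_def using assms by (intro continuous_on_circle_mean_integrand)
  have hs: "continuous_on {-pi..pi} (\<lambda>t. h (t + s))"
    by (intro continuous_on_compose2[OF h[of UNIV]] continuous_intros) auto
  have "h (x + (pi - (- pi))) = h x" for x
    by (simp add: h_def cis_mult[symmetric])
  then have "integral {-pi..pi} (\<lambda>t. h (t + s)) = integral {-pi..pi} h"
    using h \<open>s \<ge> 0\<close> by (intro integral_periodic_shift) auto
  moreover have "(\<lambda>t. norm (u (\<zeta> * (of_real r * cis t))) powr q / (2 * pi)) = (\<lambda>t. h (t + s))"
    by (simp add: h_def \<zeta> cis_mult[symmetric] mult_ac)
  ultimately show ?thesis
    unfolding h_def[symmetric]
    by (simp add: set_borel_integral_eq_integral(2) borel_integrable_atLeastAtMost' h hs)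
qed

lemma powr_convex_combination_le:
  fixes x y :: real
  assumes "1 \<le> q" "0 \<le> x" "0 \<le> y" "0 \<le> t" "t \<le> 1"
  shows "((1 - t) * x + t * y) powr q \<le> (1 - t) * x powr q + t * y powr q"
proof -
  \<comment> \<open>This settles the cases where \<open>x\<close> or \<open>y\<close> vanishes,
    since one summand then disappears; convexity on positive arguments settles the other
    case.\<close>
  have shrink: "(c * v) powr q \<le> c * v powr q" if "0 \<le> c" "c \<le> 1" "0 \<le> v" for c v :: real
  proof (cases "c = 0")
    case False
    then have "c powr q \<le> c powr 1"
      using that assms(1) by (intro powr_mono') auto
    then have "c powr q \<le> c"
      using False that by simp
    then show ?thesis
      using that by (simp add: powr_mult mult_right_mono)
  qed auto
  consider "x = 0" | "y = 0" | "x > 0" "y > 0"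
    using assms by linarith
  then show ?thesis
  proof cases
    case 3
    then show ?thesis
      using convex_onD[OF powr_convex[OF assms(1)], of t x y] assms by simp
  qed (use shrink assms in auto)
qed

text \<open>Characters only rotate \<open>f\<close> and multiply it by a unimodular constant,
  preserving the mean. Convexity of the power, used pointwise and then integrated, handles
  combinations.\<close>

lemma circle_mean_multiplier_le:
  assumes f: "f analytic_on unit_disc" and r: "0 < r" "r < 1" and "1 \<le> q"
    and x: "x \<in> circle_hull"
  shows "(LBINT t:{-pi..pi}. norm (multiplier f x (of_real r * cis t)) powr q / (2 * pi))
    \<le> (LBINT t:{-pi..pi}. norm (f (of_real r * cis t)) powr q / (2 * pi))"
  using x
proof induction
  case (character c \<zeta>)
  have "norm (multiplier f (\<lambda>k. c * \<zeta> ^ k) (of_real r * cis t))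
      = norm (f (\<zeta> * (of_real r * cis t)))" for t
    using character r by (subst multiplier_character[OF f r]) (auto simp: norm_mult)
  then show ?case
    using circle_mean_rotate[OF continuous_on_sphere[OF f r] r(1) _ character(2)] \<open>1 \<le> q\<close>
    by simp
next
  case (convex x y t)
  define X where "X = (\<lambda>s. norm (multiplier f x (of_real r * cis s)) powr q / (2 * pi))"
  define Y where "Y = (\<lambda>s. norm (multiplier f y (of_real r * cis s)) powr q / (2 * pi))"
  define I where "I = (LBINT t:{-pi..pi}. norm (f (of_real r * cis t)) powr q / (2 * pi))"
  define w where "w = (\<lambda>k. of_real (1 - t) * x k + of_real t * y k)"
  have "w \<in> circle_hull"
    unfolding w_def by (rule circle_hull.convex) (use convex in auto)
  have int: "set_integrable lborel {-pi..pi}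
      (\<lambda>s. norm (multiplier f v (of_real r * cis s)) powr q / (2 * pi))" if "v \<in> circle_hull" for v
    using that r \<open>1 \<le> q\<close> circle_hull_norm_le
    by (intro borel_integrable_atLeastAtMost' continuous_on_circle_mean_integrand
        continuous_on_multiplier[OF f]) auto
  have X: "set_integrable lborel {-pi..pi} (\<lambda>s. (1 - t) * X s)"
    and Y: "set_integrable lborel {-pi..pi} (\<lambda>s. t * Y s)"
    unfolding X_def Y_def using int convex by (auto intro!: set_integrable_mult_right)
  have pw: "norm (multiplier f w (of_real r * cis s)) powr q / (2 * pi)
      \<le> (1 - t) * X s + t * Y s" for s
  proof -
    define z where "z = of_real r * cis s"
    have "norm z = r"
      using r by (simp add: z_def norm_mult)
    have "multiplier f w z = of_real (1 - t) * multiplier f x z + of_real t * multiplier f y z"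
      unfolding w_def using convex circle_hull_norm_le \<open>norm z = r\<close>
      by (intro multiplier_linear_combination[OF f r]) auto
    then have "norm (multiplier f w z)
        \<le> (1 - t) * norm (multiplier f x z) + t * norm (multiplier f y z)"
      using norm_convex_combination_le convex by simp
    then have "norm (multiplier f w z) powr q
        \<le> ((1 - t) * norm (multiplier f x z) + t * norm (multiplier f y z)) powr q"
      using \<open>1 \<le> q\<close> by (intro powr_mono2) auto
    also have "\<dots> \<le> (1 - t) * norm (multiplier f x z) powr q + t * norm (multiplier f y z) powr q"
      by (rule powr_convex_combination_le) (use convex \<open>1 \<le> q\<close> in auto)
    finally have "norm (multiplier f w z) powr q / (2 * pi)
        \<le> ((1 - t) * norm (multiplier f x z) powr q + t * norm (multiplier f y z) powr q) / (2 * pi)"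
      by (rule divide_right_mono) simp
    then show ?thesis
      by (simp add: X_def Y_def z_def add_divide_distrib)
  qed
  have "(LBINT s:{-pi..pi}. norm (multiplier f w (of_real r * cis s)) powr q / (2 * pi))
      \<le> (LBINT s:{-pi..pi}. (1 - t) * X s + t * Y s)"
    using int[OF \<open>w \<in> circle_hull\<close>] X Y pw by (intro set_integral_mono set_integral_add) auto
  also have "\<dots> = (1 - t) * (LBINT s:{-pi..pi}. X s) + t * (LBINT s:{-pi..pi}. Y s)"
    using X Y by (simp add: set_integral_add(2))
  also have "\<dots> \<le> I"
    using convex unfolding X_def Y_def I_def by (intro convex_bound_le) auto
  finally show ?case
    by (simp add: w_def I_def)
qed

text \<open>The counterpart for the infinite exponent: rotations stay on the circle, and balls in
  the plane are convex.\<close>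

lemma sphere_sup_multiplier_le:
  assumes f: "f analytic_on unit_disc" and r: "0 < r" "r < 1"
    and x: "x \<in> circle_hull" and "norm z = r"
  shows "norm (multiplier f x z) \<le> (SUP z\<in>sphere 0 r. norm (f z))"
  using x
proof induction
  case (character c \<zeta>)
  \<comment> \<open>Compactness makes the supremum a genuine upper bound for the values on the
    circle.\<close>
  have "compact ((\<lambda>z. norm (f z)) ` sphere 0 r)"
    by (rule compact_continuous_image[OF continuous_on_norm[OF continuous_on_sphere[OF f r]]]) simp
  then have "bdd_above ((\<lambda>z. norm (f z)) ` sphere 0 r)"
    by (rule bounded_imp_bdd_above[OF compact_imp_bounded])
  then have "norm (f (\<zeta> * z)) \<le> (SUP z\<in>sphere 0 r. norm (f z))"
    by (rule cSUP_upper[rotated]) (use character \<open>norm z = r\<close> in \<open>auto simp: norm_mult\<close>)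
  then show ?case
    using character multiplier_character[OF f r character(2) \<open>norm z = r\<close>] by (simp add: norm_mult)
next
  case (convex x y t)
  have "norm (of_real (1 - t) * multiplier f x z + of_real t * multiplier f y z)
      \<le> (1 - t) * norm (multiplier f x z) + t * norm (multiplier f y z)"
    by (rule norm_convex_combination_le) (use convex in auto)
  also have "\<dots> \<le> (SUP z\<in>sphere 0 r. norm (f z))"
    by (rule convex_bound_le) (use convex in auto)
  finally show ?case
    using convex circle_hull_norm_le \<open>norm z = r\<close>
    by (subst multiplier_linear_combination[OF f r]) auto
qed

section \<open>Passage to the limit in the integral means\<close>

theorem theorem1:
  fixes f F :: "complex \<Rightarrow> complex" and p :: ereal and r :: real
  assumes "f analytic_on unit_disc"
    and "F analytic_on unit_disc"
    and "bound_preserving F"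
    and "1 \<le> p"
    and "0 < r" and "r < 1"
  shows "integral_mean p r (f \<star> F) \<le> integral_mean p r f"
proof -
  note f = assms(1) and r = assms(5,6)
  have "\<forall>m. \<exists>x. x \<in> circle_hull \<and>
      (\<forall>z\<in>sphere 0 r. norm (multiplier f x z - (f \<star> F) z) \<le> inverse (real (Suc m)))"
  proof
    fix m :: nat
    have "0 < inverse (real (Suc m))"
      by simp
    from hadamard_conv_approx[OF f r assms(3) this] show "\<exists>x. x \<in> circle_hull \<and>
      (\<forall>z\<in>sphere 0 r. norm (multiplier f x z - (f \<star> F) z) \<le> inverse (real (Suc m)))"
      by blast
  qed
  from choice[OF this] obtain x where x: "\<And>m. x m \<in> circle_hull"
    and close: "\<And>m z. z \<in> sphere 0 r \<Longrightarrow>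
      norm (multiplier f (x m) z - (f \<star> F) z) \<le> inverse (real (Suc m))"
    by blast
  have x1: "norm (x m k) \<le> 1" for m k
    using circle_hull_norm_le[OF x] .
  have lim: "(\<lambda>m. norm (multiplier f (x m) z)) \<longlonglongrightarrow> norm ((f \<star> F) z)" if "norm z = r" for z
  proof -
    have "(\<lambda>m. multiplier f (x m) z - (f \<star> F) z) \<longlonglongrightarrow> 0"
      by (rule Lim_null_comparison[OF _ LIMSEQ_inverse_real_of_nat]) (use close that in auto)
    then show ?thesis
      by (intro tendsto_norm) (simp add: LIM_zero_iff)
  qed
  show ?thesis
  proof (cases "p = \<infinity>")
    case True
    have "norm ((f \<star> F) z) \<le> (SUP z\<in>sphere 0 r. norm (f z))" if "z \<in> sphere 0 r" for z
      using that sphere_sup_multiplier_le[OF f r x]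
      by (intro LIMSEQ_le_const2[OF lim]) auto
    then have "(SUP z\<in>sphere 0 r. norm ((f \<star> F) z)) \<le> (SUP z\<in>sphere 0 r. norm (f z))"
      using r by (intro cSUP_least) auto
    then show ?thesis
      using True by (simp add: integral_mean_def)
  next
    case False
    then obtain q where q: "p = ereal q" "1 \<le> q"
      using \<open>1 \<le> p\<close> by (cases p) (auto simp: one_ereal_def)
    define u where "u = (\<lambda>g t. norm (g (of_real r * cis t) :: complex) powr q / (2 * pi))"
    define A where "A = (\<Sum>n. norm (fps_nth (fps_expansion f 0) n) * r ^ n)"
    have nr: "norm (of_real r * cis t) = r" for t
      using r by (simp add: norm_mult)
    have conv_cont: "continuous_on (sphere 0 r) (f \<star> F)"
      unfolding hadamard_conv_eq_multiplier
      by (intro continuous_on_multiplier[OF f r] bound_preserving_coeff_norm_le assms(3))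
    have int: "set_integrable lborel {-pi..pi} (u g)" if "continuous_on (sphere 0 r) g" for g
      unfolding u_def using that r q
      by (intro borel_integrable_atLeastAtMost' continuous_on_circle_mean_integrand) auto
    have int_x: "set_integrable lborel {-pi..pi} (u (multiplier f (x m)))" for m
      by (intro int continuous_on_multiplier[OF f r] x1)
    \<comment> \<open>All hull multipliers share the majorant \<open>A\<close> on the circle, so one
      constant dominates every integrand.\<close>
    have bound: "norm (u (multiplier f (x m)) t) \<le> A powr q / (2 * pi)" for m t
      unfolding u_def A_def using q multiplier_norm_le[OF f r x1 nr]
      by (auto intro!: divide_right_mono powr_mono2)
    have "(\<lambda>m. LBINT t:{-pi..pi}. u (multiplier f (x m)) t) \<longlonglongrightarrow> (LBINT t:{-pi..pi}. u (f \<star> F) t)"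
      unfolding set_lebesgue_integral_def
    proof (rule integral_dominated_convergence)
      show "integrable lborel (\<lambda>t. indicator {-pi..pi} t *\<^sub>R (A powr q / (2 * pi)))"
        using borel_integrable_atLeastAtMost'[OF continuous_on_const]
        unfolding set_integrable_def .
      show "AE t in lborel. norm (indicator {-pi..pi} t *\<^sub>R u (multiplier f (x m)) t)
          \<le> indicator {-pi..pi} t *\<^sub>R (A powr q / (2 * pi))" for m
        using bound by (intro AE_I2) (auto split: split_indicator)
      show "AE t in lborel. (\<lambda>m. indicator {-pi..pi} t *\<^sub>R u (multiplier f (x m)) t)
          \<longlonglongrightarrow> indicator {-pi..pi} t *\<^sub>R u (f \<star> F) t"
        unfolding u_def using q
        by (intro AE_I2 tendsto_intros tendsto_powr2 lim nr) auto
    qed (use int[OF conv_cont] int_x in \<open>simp_all add: set_integrable_def borel_measurable_integrable\<close>)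
    then have "(LBINT t:{-pi..pi}. u (f \<star> F) t) \<le> (LBINT t:{-pi..pi}. u f t)"
      by (rule LIMSEQ_le_const2)
        (use circle_mean_multiplier_le[OF f r q(2) x] in \<open>auto simp: u_def\<close>)
    \<comment> \<open>Nonnegativity lets the outer power \<open>1 / q\<close> be applied
      monotonically.\<close>
    moreover have "(LBINT t:{-pi..pi}. u (f \<star> F) t) \<ge> 0"
      unfolding set_lebesgue_integral_def
      by (intro Bochner_Integration.integral_nonneg) (simp add: u_def)
    ultimately show ?thesis
      using q by (simp add: integral_mean_def u_def powr_mono2)
  qed
qed

end
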